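(* Let $K$ be a field of characteristic $0$ and let $s(x)=\sum_{j=0}^{\infty}s_jx^j\in K[[x]]$ be a formal power series with $s_0\neq 0$. Let $(P_n(x))_{n\ge 1}$ be defined recursively by $P_1(x)=s_0$ and $P_n(x)=\lfloor P_{n-1}(x)\,s(x)\rfloor_n$ for $n\ge 2$. Let $Q_n(x)=x^{n-1}P_n(1/x)$ for $n\ge 1$, and let $q(t)=\sum_{n=1}^\infty Q_n(0)\,t^n$. Then $$\sum_{n=1}^\infty Q_n(x)\,t^n=\frac{q(t)}{1-x\,q(t)} .$$
   Context: For a formal power series $f(x)=\sum_{j\ge 0}f_jx^j$ and a positive integer $k$, $\lfloor f(x)\rfloor_k=f_0+f_1x+\cdots+f_{k-1}x^{k-1}$. Thus $P_n$ is a polynomial of degree at most $n-1$ and $Q_n$ is a polynomial of degree at most $n-1$ with $Q_n(0)=[x^{n-1}]P_n(x)$, where $[x^m]$ denotes extraction of the coefficient of $x^m$. The identity is an identity of formal power series in $t$ with coefficients in $K[x]$. *)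

theory Defs
  imports "HOL-Computational_Algebra.Computational_Algebra"
begin

text \<open>
  The polynomial \<open>x\<^sup>m p(1/x)\<close>, for \<open>p\<close> of degree at most \<open>m\<close>.  It differs from
  \<open>reflect_poly p\<close> by a power of \<open>x\<close> if the degree of \<open>p\<close> is smaller than \<open>m\<close>.
\<close>

definition reverse_poly :: "nat \<Rightarrow> 'a::comm_semiring_1 poly \<Rightarrow> 'a poly" where
  "reverse_poly m p = (\<Sum>j\<le>m. monom (coeff p j) (m - j))"

text \<open>The defining equation, read in the field of fractions of \<open>K[x]\<close>.\<close>

lemma reverse_poly_fract:
  fixes p :: "'a::field poly"
  assumes "degree p \<le> m"
  shows "to_fract (reverse_poly m p) =
    to_fract [:0, 1:] ^ m * poly (map_poly (\<lambda>c. to_fract [:c:]) p) (1 / to_fract [:0, 1:])"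
proof -
  let ?X = "to_fract [:0, 1 :: 'a:]"
  have X: "?X \<noteq> 0" by simp
  have pow: "to_fract (q ^ k) = to_fract q ^ k" for q :: "'a poly" and k
    by (induction k) simp_all
  have mon: "to_fract (monom c k) = to_fract [:c:] * ?X ^ k" for c :: 'a and k
    by (simp only: pow[symmetric] to_fract_mult[symmetric] monom_altdef) simp
  have sum: "to_fract (sum f A) = (\<Sum>i\<in>A. to_fract (f i))" for f :: "nat \<Rightarrow> 'a poly" and A
    by (induction A rule: infinite_finite_induct) simp_all
  have deg: "degree (map_poly (\<lambda>c. to_fract [:c:]) p) \<le> m"
    by (intro degree_le) (use assms in \<open>auto simp: coeff_map_poly coeff_eq_0\<close>)
  have summand: "to_fract (monom (coeff p j) (m - j)) = ?X ^ m * (to_fract [:coeff p j:] * (1 / ?X) ^ j)"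
    if "j \<le> m" for j
    unfolding mon using X that by (simp add: power_diff power_one_over)
  have "poly (map_poly (\<lambda>c. to_fract [:c:]) p) (1 / ?X) =
      (\<Sum>j\<le>m. coeff (map_poly (\<lambda>c. to_fract [:c:]) p) j * (1 / ?X) ^ j)"
    unfolding poly_altdef
    by (rule sum.mono_neutral_left) (use deg in \<open>auto simp: coeff_eq_0\<close>)
  also have "\<dots> = (\<Sum>j\<le>m. to_fract [:coeff p j:] * (1 / ?X) ^ j)"
    by (subst coeff_map_poly) simp_all
  finally have ev: "poly (map_poly (\<lambda>c. to_fract [:c:]) p) (1 / ?X) =
      (\<Sum>j\<le>m. to_fract [:coeff p j:] * (1 / ?X) ^ j)" .
  show ?thesis
    unfolding reverse_poly_def sum ev sum_distrib_left by (rule sum.cong) (simp_all add: summand)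
qed

text \<open>
  The quotient \<open>f / g\<close> of power series over a commutative ring, for \<open>g\<close> with constant
  coefficient \<open>1\<close>.  The division \<open>f / g\<close> of the library needs an \<open>inverse\<close> on
  the coefficients, which \<open>K[x]\<close> does not have.
\<close>

definition fps_quot :: "'a::comm_ring_1 fps \<Rightarrow> 'a fps \<Rightarrow> 'a fps" where
  "fps_quot f g = f * fps_right_inverse g 1"

lemma fps_quot_unique:
  fixes f g h :: "'a::comm_ring_1 fps"
  assumes "fps_nth g 0 = 1"
  shows "h = fps_quot f g \<longleftrightarrow> h * g = f"
proof -
  have inv: "g * fps_right_inverse g 1 = 1"
    by (rule fps_right_inverse) (simp add: assms)
  have "f * fps_right_inverse g 1 * g = f * (g * fps_right_inverse g 1)"
    by (simp only: mult.assoc mult.commute[of g])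
  hence "f * fps_right_inverse g 1 * g = f"
    unfolding inv by simp
  moreover have "h * g * fps_right_inverse g 1 = h"
    unfolding mult.assoc inv by simp
  ultimately show ?thesis
    unfolding fps_quot_def by auto
qed

end

theory Submission
  imports Defs
begin

text \<open>
  Let \<open>A\<close> be the solution of \<open>A = t s(A)\<close>, the compositional inverse of \<open>t/s(t)\<close>.  Multiplying this
  equation by \<open>A\<^sup>k\<close> and extracting coefficients gives a recursion for the numbers \<open>[t\<^sup>n] A\<^sup>k\<close> which is
  the recursion for the coefficients of \<open>P\<^sub>n\<close>; hence \<open>[x\<^sup>j] P\<^sub>n = [t\<^sup>n] A\<^sup>n\<^sup>-\<^sup>j\<close> for \<open>j < n\<close>, that is,
  \<open>[x\<^sup>m] Q\<^sub>n = [t\<^sup>n] A\<^sup>m\<^sup>+\<^sup>1\<close>.  In particular \<open>q = A\<close>, and the sum of \<open>x\<^sup>m q\<^sup>m\<^sup>+\<^sup>1\<close> over \<open>m\<close> is a geometric series.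
\<close>

lemma fps_functional_equation_solution:
  fixes s :: "'a::field fps"
  assumes "fps_nth s 0 \<noteq> 0"
  obtains A where "fps_nth A 0 = 0" and "A = fps_X * (s oo A)"
proof -
  define g where "g = fps_X * inverse s"
  define A where "A = fps_inv g"
  have A0: "fps_nth A 0 = 0"
    by (simp add: A_def fps_inv_def)
  have s: "inverse s * s = 1"
    using assms by (rule inverse_mult_eq_1)
  have "g oo A = fps_X"
    \<comment> \<open>\<open>g\<close> has constant coefficient 0 and linear coefficient
      \<open>1 / s_0\<close>, which is nonzero, so it is invertible under composition.\<close>
    unfolding A_def by (rule fps_inv_right) (use assms in \<open>simp_all add: g_def\<close>)
  hence "fps_X * (s oo A) = (g * s) oo A"
    using A0 by (simp add: fps_compose_mult_distrib)
  also have "g * s = fps_X"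
    by (simp add: g_def mult.assoc s)
  also have "fps_X oo A = A"
    using A0 by (simp add: fps_X_fps_compose_startby0)
  finally show thesis
    using that A0 by simp
qed

text \<open>Multiplying the equation for \<open>A\<close> by \<open>A ^ (n - j)\<close> gives the
  terms \<open>s_i A ^ (i + n - j)\<close>; those with \<open>i > j\<close> have order above
  \<open>n\<close> and drop out. The exponent is written \<open>n - (j - i)\<close> to match the
  coefficient of \<open>P n\<close> at \<open>j - i\<close>.\<close>

lemma fps_nth_power_functional_equation:
  fixes A s :: "'a::idom fps"
  assumes A0: "fps_nth A 0 = 0" and A: "A = fps_X * (s oo A)" and "j \<le> n"
  shows "fps_nth (A ^ (Suc n - j)) (Suc n) = (\<Sum>i\<le>j. fps_nth s i * fps_nth (A ^ (n - (j - i))) n)"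
proof -
  define k where "k = n - j"
  have "A ^ (Suc n - j) = fps_X * (A ^ k * (s oo A))"
    using \<open>j \<le> n\<close> by (subst A) (simp add: Suc_diff_le k_def A[symmetric] mult_ac)
  hence "fps_nth (A ^ (Suc n - j)) (Suc n) = fps_nth ((s oo A) * A ^ k) n"
    by (simp add: mult.commute)
  also have "\<dots> = (\<Sum>l\<le>n. (\<Sum>i\<le>l. fps_nth s i * fps_nth (A ^ i) l) * fps_nth (A ^ k) (n - l))"
    by (simp add: fps_mult_nth fps_compose_nth atMost_atLeast0)
  also have "\<dots> = (\<Sum>l\<le>n. \<Sum>i\<le>n. fps_nth s i * fps_nth (A ^ i) l * fps_nth (A ^ k) (n - l))"
  proof (rule sum.cong[OF refl])
    fix l assume "l \<in> {..n}"
    \<comment> \<open>\<open>A ^ i\<close> has order at least \<open>i\<close>, so the range of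
      \<open>i\<close> can be made independent of \<open>l\<close>, which allows the sums to be
      swapped.\<close>
    hence "(\<Sum>i\<le>l. fps_nth s i * fps_nth (A ^ i) l) = (\<Sum>i\<le>n. fps_nth s i * fps_nth (A ^ i) l)"
      using A0 by (intro sum.mono_neutral_left) (auto intro: startsby_zero_power_prefix[rule_format])
    thus "(\<Sum>i\<le>l. fps_nth s i * fps_nth (A ^ i) l) * fps_nth (A ^ k) (n - l) =
        (\<Sum>i\<le>n. fps_nth s i * fps_nth (A ^ i) l * fps_nth (A ^ k) (n - l))"
      by (simp add: sum_distrib_right)
  qed
  also have "\<dots> = (\<Sum>i\<le>n. fps_nth s i * fps_nth (A ^ (i + k)) n)"
    by (subst sum.swap) (simp add: power_add fps_mult_nth sum_distrib_left atMost_atLeast0 mult.assoc)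
  also have "\<dots> = (\<Sum>i\<le>j. fps_nth s i * fps_nth (A ^ (i + k)) n)"
    using A0 \<open>j \<le> n\<close>
    by (intro sum.mono_neutral_right) (auto simp: k_def intro: startsby_zero_power_prefix[rule_format])
  also have "\<dots> = (\<Sum>i\<le>j. fps_nth s i * fps_nth (A ^ (n - (j - i))) n)"
    using \<open>j \<le> n\<close> by (intro sum.cong) (auto simp: k_def intro!: arg_cong[where f = "\<lambda>e. fps_nth (A ^ e) n"])
  finally show ?thesis .
qed

lemma coeff_truncated_powers:
  fixes s A :: "'a::field fps" and P :: "nat \<Rightarrow> 'a poly"
  assumes A0: "fps_nth A 0 = 0" and A: "A = fps_X * (s oo A)"
    and P_1: "P 1 = [:fps_nth s 0:]"
    and P_rec: "\<And>n. n \<ge> 2 \<Longrightarrow> P n = truncate_fps n (fps_of_poly (P (n - 1)) * s)"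
  shows "coeff (P (Suc n)) j = (if j \<le> n then fps_nth (A ^ (Suc n - j)) (Suc n) else 0)"
proof (induction n arbitrary: j)
  case 0
  have "fps_nth A (Suc 0) = fps_nth s 0"
    by (subst A) simp
  thus ?case
    using P_1 by (auto simp: coeff_pCons split: nat.splits)
next
  case (Suc n)
  have "coeff (P (Suc (Suc n))) j = fps_nth (A ^ (Suc (Suc n) - j)) (Suc (Suc n))" if j: "j \<le> Suc n"
  proof -
    have "coeff (P (Suc (Suc n))) j = (\<Sum>i\<le>j. fps_nth s i * coeff (P (Suc n)) (j - i))"
      using P_rec[of "Suc (Suc n)"] j
      by (simp add: coeff_truncate_fps mult.commute[of _ s] fps_mult_nth atMost_atLeast0)
    \<comment> \<open>The boundary case \<open>j = Suc n\<close>, \<open>i = 0\<close> lies beyond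
      the truncation of \<open>P (Suc n)\<close>; there the right side has \<open>A ^ 0 = 1\<close>,
      whose coefficient at \<open>Suc n\<close> is 0 as well.\<close>
    also have "\<dots> = (\<Sum>i\<le>j. fps_nth s i * fps_nth (A ^ (Suc n - (j - i))) (Suc n))"
      using j by (intro sum.cong refl) (auto simp: Suc not_le dest!: le_antisym[of "Suc n"])
    finally show ?thesis
      using fps_nth_power_functional_equation[OF A0 A j] by simp
  qed
  thus ?case
    using P_rec[of "Suc (Suc n)"] by (auto simp: coeff_truncate_fps)
qed

lemma coeff_reverse_poly:
  "coeff (reverse_poly m p) i = (if i \<le> m then coeff p (m - i) else 0)"
proof -
  have "coeff (reverse_poly m p) i = (\<Sum>j\<le>m. if j = m - i \<and> i \<le> m then coeff p j else 0)"
    unfolding reverse_poly_def coeff_sum by (intro sum.cong) auto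
  thus ?thesis
    by (cases "i \<le> m") simp_all
qed

text \<open>Multiplying \<open>B\<close> by \<open>q\<close> raises each exponent of
  \<open>A\<close> by one and multiplying by \<open>x\<close> shifts \<open>m\<close> by one, so
  \<open>B - x q B\<close> telescopes to its term at \<open>m = 0\<close>, which is
  \<open>q\<close>. No infinite sum has to be formed.\<close>

lemma geometric_fps_quot:
  fixes A :: "'a::comm_ring_1 fps" and B :: "'a poly fps"
  assumes A0: "fps_nth A 0 = 0"
    and B: "\<And>n m. coeff (fps_nth B n) m = fps_nth (A ^ Suc m) n"
  shows "B = fps_quot (Abs_fps (\<lambda>n. [:fps_nth A n:]))
    (1 - fps_const [:0, 1:] * Abs_fps (\<lambda>n. [:fps_nth A n:]))"
proof -
  define q where "q = Abs_fps (\<lambda>n. [:fps_nth A n:])"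
  have q_nth: "fps_nth q n = [:fps_nth A n:]" for n
    by (simp add: q_def)
  have Bq: "coeff (fps_nth (q * B) n) m = fps_nth (A ^ Suc (Suc m)) n" for n m
    by (simp add: q_nth fps_mult_nth coeff_sum B power_Suc[of A "Suc m"] del: power_Suc)
  have "fps_nth (B - fps_const [:0, 1:] * (q * B)) n = fps_nth q n" for n
    by (rule poly_eqI) (auto simp: B Bq q_nth coeff_pCons simp del: power_Suc split: nat.splits)
  hence "B * (1 - fps_const [:0, 1:] * q) = q"
    by (intro fps_ext) (simp add: algebra_simps)
  moreover have "fps_nth (1 - fps_const [:0, 1:] * q) 0 = 1"
    using A0 by (simp add: q_def)
  ultimately show ?thesis
    unfolding q_def[symmetric] by (simp add: fps_quot_unique)
qed

theorem mainTheorem2: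
  fixes s :: "'a::field_char_0 fps"
    and P Q :: "nat \<Rightarrow> 'a poly"
    and q :: "'a poly fps"
  assumes s0: "fps_nth s 0 \<noteq> 0"
    and P_1: "P 1 = [:fps_nth s 0:]"
    and P_rec: "\<And>n. n \<ge> 2 \<Longrightarrow> P n = truncate_fps n (fps_of_poly (P (n - 1)) * s)"
    and Q: "\<And>n. n \<ge> 1 \<Longrightarrow> Q n = reverse_poly (n - 1) (P n)"
    and q: "q = Abs_fps (\<lambda>n. if n = 0 then 0 else [:poly (Q n) 0:])"
  shows "Abs_fps (\<lambda>n. if n = 0 then 0 else Q n) =
    fps_quot q (1 - fps_const [:0, 1:] * q)"
proof -
  obtain A where A0: "fps_nth A 0 = 0" and A: "A = fps_X * (s oo A)"
    using fps_functional_equation_solution[OF s0] .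
  define B where "B = Abs_fps (\<lambda>n. if n = 0 then 0 else Q n)"
  have B: "coeff (fps_nth B n) m = fps_nth (A ^ Suc m) n" for n m
  proof (cases n)
    case 0
    thus ?thesis
      using A0 by (simp add: B_def)
  next
    case (Suc l)
    have "coeff (Q (Suc l)) m = fps_nth (A ^ Suc m) (Suc l)"
    proof (cases "m \<le> l")
      case True
      thus ?thesis
        by (simp add: Q coeff_reverse_poly coeff_truncated_powers[OF A0 A P_1 P_rec] Suc_diff_le)
    next
      case False
      \<comment> \<open>Both sides vanish: \<open>m\<close> exceeds the degree bound
        \<open>l\<close>, and \<open>A ^ Suc m\<close> has order above \<open>Suc l\<close>.\<close>
      thus ?thesis
        using A0 startsby_zero_power_prefix[of A "Suc m"] by (simp add: Q coeff_reverse_poly)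
    qed
    thus ?thesis
      by (simp add: B_def Suc)
  qed
  \<comment> \<open>This is the case \<open>m = 0\<close> of \<open>B\<close>; at
    \<open>n = 0\<close> both sides are 0 because \<open>A\<close> has no constant
    coefficient.\<close>
  have "q = Abs_fps (\<lambda>n. [:fps_nth A n:])"
  proof (rule fps_ext)
    fix n
    show "fps_nth q n = fps_nth (Abs_fps (\<lambda>n. [:fps_nth A n:])) n"
      using B[of n 0] A0 by (simp add: q B_def poly_0_coeff_0 split: if_splits)
  qed
  thus ?thesis
    using geometric_fps_quot[OF A0 B] by (simp add: B_def)
qed

end
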